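(* Let $h:V\to V$ be an automorphism of the clan $(V,\Delta,e)$, that is, an invertible linear map with $h(e)=e$ and $h(u\Delta v)=h(u)\Delta h(v)$ for all $u,v\in V$. Then $h(\Omega)=\Omega$ and, for all $x,y\in\Omega$ and $0\le t\le1$, $$\mathrm{Log}_\Delta(hx)=h\,\mathrm{Log}_\Delta(x),\qquad h\bigl(\gamma^\Delta_{x,y}(t)\bigr)=\gamma^\Delta_{h(x),h(y)}(t).$$ Moreover, $h$ is an isometry of $(\Omega,g^\Delta)$.
   Context: Let $V\subset \mathrm{Sym}(3,\mathbb{R})$ be the 5-dimensional space of real symmetric $3\times3$ matrices whose $(1,2)$ and $(2,1)$ entries are $0$, let $e=I_3$, and let $\Omega\subset V$ be the open cone of positive definite matrices in $V$. Each $x\in\Omega$ has a unique lower triangular Cholesky factor $T_x$ with positive diagonal and $x=T_xT_x^{\top}$. For $v\in V$ let $\underline{v}$ be the unique lower triangular matrix with $v=\underline v+\underline v^{\top}$. The clan product on $V$ is $u\Delta w=\underline u\,w+w\,\underline u^{\top}$, $L_u(w)=u\Delta w$, and $Q_\Delta(u,v)=\mathrm{tr}(L_{u\Delta v})$, an inner product on $V$. The clan exponential $\mathrm{Exp}_\Delta:V\to\Omega$, $\mathrm{Exp}_\Delta(v)=\exp(L_v)e=\exp(\underline v)\exp(\underline v)^{\top}$, is a diffeomorphism with inverse $\mathrm{Log}_\Delta(x)=\log(T_x)+\log(T_x)^{\top}$ (principal logarithm). The Log-Vinberg path is $\gamma^\Delta_{x,y}(t)=\mathrm{Exp}_\Delta\bigl((1-t)\mathrm{Log}_\Delta(x)+t\,\mathrm{Log}_\Delta(y)\bigr)$,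 and $g^\Delta_x(u,v)=Q_\Delta\bigl((d\mathrm{Log}_\Delta)_xu,(d\mathrm{Log}_\Delta)_xv\bigr)$. *)

theory Defs
  imports "HOL-Analysis.Analysis"
begin

type_synonym mat3 = "real^3^3"

definition V :: "mat3 set" where
  "V = {x. transpose x = x \<and> x $ 1 $ 2 = 0 \<and> x $ 2 $ 1 = 0}"

definition pos_def :: "mat3 \<Rightarrow> bool" where
  "pos_def x \<longleftrightarrow> transpose x = x \<and> (\<forall>z. z \<noteq> 0 \<longrightarrow> z \<bullet> (x *v z) > 0)"

definition \<Omega> :: "mat3 set" where
  "\<Omega> = {x \<in> V. pos_def x}"

abbreviation e :: mat3 where
  "e \<equiv> mat 1"

(* The entries above the diagonal are listed explicitly because 3 = 0 in the
   numeral type 3, so its built-in order is 3 < 1 < 2. *)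
definition lower_triangular :: "mat3 \<Rightarrow> bool" where
  "lower_triangular A \<longleftrightarrow> A $ 1 $ 2 = 0 \<and> A $ 1 $ 3 = 0 \<and> A $ 2 $ 3 = 0"

definition cholesky :: "mat3 \<Rightarrow> mat3" where
  "cholesky x = (THE T. lower_triangular T \<and> (\<forall>i. T $ i $ i > 0) \<and> x = T ** transpose T)"

definition lower :: "mat3 \<Rightarrow> mat3" where
  "lower v = (THE A. lower_triangular A \<and> v = A + transpose A)"

definition clan_prod :: "mat3 \<Rightarrow> mat3 \<Rightarrow> mat3"  (infixl \<open>\<Delta>\<close> 70) where
  "u \<Delta> w = lower u ** w + w ** transpose (lower u)"

definition L :: "mat3 \<Rightarrow> mat3 \<Rightarrow> mat3" where
  "L u w = u \<Delta> w"

(* Trace of an endomorphism f of a finite-dimensional subspace S: the sum of the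
   diagonal coefficients of f in a basis of S (independent of the basis chosen). *)
definition trace_on :: "'a::real_vector set \<Rightarrow> ('a \<Rightarrow> 'a) \<Rightarrow> real" where
  "trace_on S f =
     (let B = (SOME B. B \<subseteq> S \<and> independent B \<and> span B = S)
      in \<Sum>b\<in>B. representation B (f b) b)"

definition Q :: "mat3 \<Rightarrow> mat3 \<Rightarrow> real" where
  "Q u v = trace_on V (L (u \<Delta> v))"

(* (exp f) x for a linear operator f, by the exponential series. *)
definition op_exp :: "('a \<Rightarrow> 'a) \<Rightarrow> 'a \<Rightarrow> 'a::real_normed_vector" where
  "op_exp f x = (\<Sum>k. (1 / fact k) *\<^sub>R (f ^^ k) x)"

(* Matrix exponential; the k-th power of A is obtained by iterating A ** _ on the identity,
   as the type of matrices carries no algebra structure in the library. *)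
definition mat_exp :: "mat3 \<Rightarrow> mat3" where
  "mat_exp A = op_exp (\<lambda>X. A ** X) (mat 1)"

definition complex_eigenvalue :: "mat3 \<Rightarrow> complex \<Rightarrow> bool" where
  "complex_eigenvalue A \<mu> \<longleftrightarrow> (\<exists>z. z \<noteq> 0 \<and> map_matrix complex_of_real A *v z = \<mu> *s z)"

(* Principal logarithm of a real matrix without eigenvalues in the closed negative half-line:
   the unique logarithm whose eigenvalues lie in the open strip |Im| < pi; it is real. *)
definition mat_log :: "mat3 \<Rightarrow> mat3" where
  "mat_log A = (THE X. mat_exp X = A \<and> (\<forall>\<mu>. complex_eigenvalue X \<mu> \<longrightarrow> \<bar>Im \<mu>\<bar> < pi))"

definition Exp :: "mat3 \<Rightarrow> mat3" where
  "Exp v = op_exp (L v) e"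

definition Log :: "mat3 \<Rightarrow> mat3" where
  "Log x = mat_log (cholesky x) + transpose (mat_log (cholesky x))"

definition log_vinberg_path :: "mat3 \<Rightarrow> mat3 \<Rightarrow> real \<Rightarrow> mat3" where
  "log_vinberg_path x y t = Exp ((1 - t) *\<^sub>R Log x + t *\<^sub>R Log y)"

(* Differential at x of a map on the relatively open subset \<Omega> of V. It is taken within \<Omega>,
   so it is meaningful (and uniquely determined) on vectors of V only. *)
definition diff_at :: "(mat3 \<Rightarrow> mat3) \<Rightarrow> mat3 \<Rightarrow> mat3 \<Rightarrow> mat3" where
  "diff_at f x = frechet_derivative f (at x within \<Omega>)"

definition log_metric :: "mat3 \<Rightarrow> mat3 \<Rightarrow> mat3 \<Rightarrow> real" where
  "log_metric x u v = Q (diff_at Log x u) (diff_at Log x v)"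

(* f is k times continuously differentiable on \<Omega>: all iterated directional derivatives
   in directions of V exist as Frechet differentials and are continuous. *)
primrec Ck_on_cone :: "nat \<Rightarrow> (mat3 \<Rightarrow> mat3) \<Rightarrow> bool" where
  "Ck_on_cone 0 f \<longleftrightarrow> continuous_on \<Omega> f"
| "Ck_on_cone (Suc k) f \<longleftrightarrow>
     f differentiable_on \<Omega> \<and> (\<forall>u\<in>V. Ck_on_cone k (\<lambda>x. diff_at f x u))"

definition cone_diffeomorphism :: "(mat3 \<Rightarrow> mat3) \<Rightarrow> bool" where
  "cone_diffeomorphism f \<longleftrightarrow>
     bij_betw f \<Omega> \<Omega> \<and> (\<forall>k. Ck_on_cone k f) \<and> (\<forall>k. Ck_on_cone k (inv_into \<Omega> f))"

definition cone_isometry :: "(mat3 \<Rightarrow> mat3 \<Rightarrow> mat3 \<Rightarrow> real) \<Rightarrow> (mat3 \<Rightarrow> mat3) \<Rightarrow> bool" where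
  "cone_isometry g f \<longleftrightarrow>
     cone_diffeomorphism f \<and>
     (\<forall>x\<in>\<Omega>. \<forall>u\<in>V. \<forall>v\<in>V. g (f x) (diff_at f x u) (diff_at f x v) = g x u v)"

(* Only the restriction of h to V matters; its values outside V are unconstrained. *)
definition clan_automorphism :: "(mat3 \<Rightarrow> mat3) \<Rightarrow> bool" where
  "clan_automorphism h \<longleftrightarrow>
     bij_betw h V V \<and>
     (\<forall>u\<in>V. \<forall>v\<in>V. h (u + v) = h u + h v) \<and>
     (\<forall>c. \<forall>u\<in>V. h (c *\<^sub>R u) = c *\<^sub>R h u) \<and>
     h e = e \<and>
     (\<forall>u\<in>V. \<forall>v\<in>V. h (u \<Delta> v) = h u \<Delta> h v)"

end

(* An automorphism of the clan permutes the few algebraically distinguished elements: the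
   off-diagonal part consists of elements n with n \<Delta> (n \<Delta> n) = 0, its square is the line of
   the idempotent E3, and the annihilator of E3 has only E1, E2 and E1 + E2 as nonzero idempotents.
   Hence h changes the signs of the two off-diagonal coordinates, possibly after exchanging the
   indices 1 and 2. In coordinates Log is explicit, its off-diagonal entries being quotients by
   divided differences of exp, and it visibly commutes with h; Exp commutes with h because
   h L_v = L_(h v) h, and Q is a trace, which h preserves. Since Log is differentiable on the cone,
   differentiating Log h = h Log gives the isometry. *)
theory Submission
  imports Defs "HOL-Computational_Algebra.Fundamental_Theorem_Algebra"
begin

section \<open>Coordinates on the space and the cone\<close>

text \<open>\<open>Log\<close> is not defined as the inverse of \<open>Exp\<close> but through two
  unique objects, the Cholesky factor and the principal logarithm, so its equivariance is read off
  from an evaluated formula. The obstacle is the logarithm: the competitors in its uniqueness claim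
  are arbitrary real matrices, not only triangular ones. They become triangular because a logarithm
  with spectrum in the strip |Im| < pi inherits the eigenvectors of its exponential for positive
  eigenvalues. A second obstacle is that \<open>\<Omega>\<close> has empty interior in the space of
  all matrices and that \<open>h\<close> is arbitrary off \<open>V\<close>. Differentials are
  therefore taken within \<open>\<Omega>\<close> and trusted on \<open>V\<close> only, and
  \<open>h\<close> is replaced by \<open>h \<circ> V_proj\<close> wherever a linear map is required.
  The differential of \<open>Log\<close> is never computed. Its existence is delicate only where the
  last diagonal Cholesky entry equals one of the other two and a divided difference becomes 0/0; a
  power series covers that case.\<close>

definition vmat :: "real \<Rightarrow> real \<Rightarrow> real \<Rightarrow> real \<Rightarrow> real \<Rightarrow> mat3" where
  "vmat a b c p q = vector [vector [a, 0, p], vector [0, b, q], vector [p, q, c]]"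

definition tri :: "real \<Rightarrow> real \<Rightarrow> real \<Rightarrow> real \<Rightarrow> real \<Rightarrow> mat3" where
  "tri a b c p q = vector [vector [a, 0, 0], vector [0, b, 0], vector [p, q, c]]"

lemma mat3_eqI:
  fixes A B :: "'a^3^3"
  assumes "A$1$1 = B$1$1" "A$1$2 = B$1$2" "A$1$3 = B$1$3" "A$2$1 = B$2$1" "A$2$2 = B$2$2"
    "A$2$3 = B$2$3" "A$3$1 = B$3$1" "A$3$2 = B$3$2" "A$3$3 = B$3$3"
  shows "A = B"
  using assms by (simp add: vec_eq_iff forall_3)

lemma tri_nth [simp]:
  "tri a b c p q $ 1 $ 1 = a" "tri a b c p q $ 1 $ 2 = 0" "tri a b c p q $ 1 $ 3 = 0"
  "tri a b c p q $ 2 $ 1 = 0" "tri a b c p q $ 2 $ 2 = b" "tri a b c p q $ 2 $ 3 = 0"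
  "tri a b c p q $ 3 $ 1 = p" "tri a b c p q $ 3 $ 2 = q" "tri a b c p q $ 3 $ 3 = c"
  by (simp_all add: tri_def)

lemma vmat_nth [simp]:
  "vmat a b c p q $ 1 $ 1 = a" "vmat a b c p q $ 1 $ 2 = 0" "vmat a b c p q $ 1 $ 3 = p"
  "vmat a b c p q $ 2 $ 1 = 0" "vmat a b c p q $ 2 $ 2 = b" "vmat a b c p q $ 2 $ 3 = q"
  "vmat a b c p q $ 3 $ 1 = p" "vmat a b c p q $ 3 $ 2 = q" "vmat a b c p q $ 3 $ 3 = c"
  by (simp_all add: vmat_def)

lemma mat3_mult_nth:
  fixes A B :: "'a::semiring_1^3^3"
  shows "(A ** B) $ i $ j = A$i$1 * B$1$j + A$i$2 * B$2$j + A$i$3 * B$3$j"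
  by (simp add: matrix_matrix_mult_def sum_3)

lemma transpose_nth: "transpose A $ i $ j = A $ j $ i"
  by (simp add: transpose_def)

lemma mat_1_nth3 [simp]:
  "(mat 1 :: 'a::zero_neq_one^3^3) $ 1 $ 2 = 0" "(mat 1 :: 'a^3^3) $ 1 $ 3 = 0"
  "(mat 1 :: 'a^3^3) $ 2 $ 1 = 0" "(mat 1 :: 'a^3^3) $ 2 $ 3 = 0"
  "(mat 1 :: 'a^3^3) $ 3 $ 1 = 0" "(mat 1 :: 'a^3^3) $ 3 $ 2 = 0"
  "(mat 1 :: 'a^3^3) $ i $ i = 1"
  by (simp_all add: mat_def)

lemma vmat_eq_iff [simp]:
  "vmat a b c p q = vmat a' b' c' p' q' \<longleftrightarrow> a = a' \<and> b = b' \<and> c = c' \<and> p = p' \<and> q = q'"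
  by (metis vmat_nth)

lemma vmat_in_V [simp]: "vmat a b c p q \<in> V"
  unfolding V_def by (auto intro!: mat3_eqI simp: transpose_nth)

lemma V_eq_vmat:
  assumes "x \<in> V"
  shows "x = vmat (x$1$1) (x$2$2) (x$3$3) (x$1$3) (x$2$3)"
proof -
  have "transpose x $ i $ j = x $ i $ j" for i j
    using assms by (simp add: V_def)
  then have "x $ j $ i = x $ i $ j" for i j
    by (simp add: transpose_nth)
  then show ?thesis
    using assms unfolding V_def by (intro mat3_eqI) auto
qed

lemma V_cases:
  assumes "x \<in> V"
  obtains a b c p q where "x = vmat a b c p q"
  using V_eq_vmat[OF assms] by blast

lemma vmat_add [simp]:
  "vmat a b c p q + vmat a' b' c' p' q' = vmat (a + a') (b + b') (c + c') (p + p') (q + q')"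
  by (rule mat3_eqI) simp_all

lemma vmat_scaleR [simp]:
  "r *\<^sub>R vmat a b c p q = vmat (r * a) (r * b) (r * c) (r * p) (r * q)"
  by (rule mat3_eqI) simp_all

lemma mat_1_eq_vmat: "mat 1 = vmat 1 1 1 0 0"
  by (rule mat3_eqI) simp_all

lemma subspace_V: "subspace V"
proof (rule subspaceI)
  have "(0 :: mat3) = vmat 0 0 0 0 0"
    by (rule mat3_eqI) simp_all
  then show "0 \<in> V" by (metis vmat_in_V)
next
  fix x y assume "x \<in> V" "y \<in> V"
  then show "x + y \<in> V" by (metis V_cases vmat_add vmat_in_V)
next
  fix c x assume "x \<in> V"
  then show "c *\<^sub>R x \<in> V" by (metis V_cases vmat_scaleR vmat_in_V)
qed

lemma lower_vmat: "lower (vmat a b c p q) = tri (a/2) (b/2) (c/2) p q"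
  unfolding lower_def
proof (rule the_equality, goal_cases)
  case 1
  show ?case
    by (auto simp: lower_triangular_def transpose_nth intro!: mat3_eqI)
next
  case (2 A)
  then have lt: "lower_triangular A" and eq: "vmat a b c p q = A + transpose A"
    by blast+
  have ent: "vmat a b c p q $ i $ j = A $ i $ j + A $ j $ i" for i j
    by (simp only: eq vector_add_component transpose_nth)
  show ?case
    using lt ent[of 1 1] ent[of 2 2] ent[of 3 3] ent[of 2 1] ent[of 3 1] ent[of 3 2]
    by (intro mat3_eqI) (auto simp: lower_triangular_def)
qed

lemma clan_prod_vmat:
  "vmat a b c p q \<Delta> vmat a' b' c' p' q' =
    vmat (a * a') (b * b') (c * c' + 2 * (p * p' + q * q'))
      ((a + c) / 2 * p' + p * a') ((b + c) / 2 * q' + q * b')"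
  unfolding clan_prod_def lower_vmat
  by (intro mat3_eqI) (simp_all add: mat3_mult_nth transpose_nth field_simps)

lemma clan_prod_in_V [simp]: "u \<in> V \<Longrightarrow> v \<in> V \<Longrightarrow> u \<Delta> v \<in> V"
  by (metis V_cases clan_prod_vmat vmat_in_V)

text \<open>Completing squares in the first two variables leaves the Schur complement of the block
  diag(a, b) as the coefficient of the third.\<close>

lemma pos_def_vmat:
  "pos_def (vmat a b c p q) \<longleftrightarrow> 0 < a \<and> 0 < b \<and> 0 < c - p\<^sup>2 / a - q\<^sup>2 / b"
proof -
  have form: "z \<bullet> (vmat a b c p q *v z) =
      a * (z$1)\<^sup>2 + b * (z$2)\<^sup>2 + c * (z$3)\<^sup>2 + 2 * p * z$1 * z$3 + 2 * q * z$2 * z$3" for z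
    by (simp add: inner_vec_def sum_3 matrix_vector_mult_def algebra_simps power2_eq_square)
  have sym: "transpose (vmat a b c p q) = vmat a b c p q"
    using vmat_in_V by (simp add: V_def)
  show ?thesis
  proof (intro iffI)
    assume "pos_def (vmat a b c p q)"
    then have pos: "z \<noteq> 0 \<Longrightarrow>
        a * (z$1)\<^sup>2 + b * (z$2)\<^sup>2 + c * (z$3)\<^sup>2 + 2 * p * z$1 * z$3 + 2 * q * z$2 * z$3 > 0" for z :: "real^3"
      unfolding pos_def_def form by blast
    have a: "0 < a"
      using pos[of "vector [1, 0, 0]"] by (simp add: vec_eq_iff forall_3)
    have b: "0 < b"
      using pos[of "vector [0, 1, 0]"] by (simp add: vec_eq_iff forall_3)
    \<comment> \<open>The test vector makes both completed squares vanish, so the form takes exactly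
      the value of the Schur complement there.\<close>
    have "0 < c - p\<^sup>2 / a - q\<^sup>2 / b"
      using pos[of "vector [- p / a, - q / b, 1]"] a b
      by (simp add: vec_eq_iff forall_3 power_divide power2_eq_square)
    with a b show "0 < a \<and> 0 < b \<and> 0 < c - p\<^sup>2 / a - q\<^sup>2 / b" by blast
  next
    assume *: "0 < a \<and> 0 < b \<and> 0 < c - p\<^sup>2 / a - q\<^sup>2 / b"
    have "z \<bullet> (vmat a b c p q *v z) > 0" if "z \<noteq> 0" for z
    proof -
      have eq: "z \<bullet> (vmat a b c p q *v z) =
          a * (z$1 + p / a * z$3)\<^sup>2 + b * (z$2 + q / b * z$3)\<^sup>2 + (c - p\<^sup>2 / a - q\<^sup>2 / b) * (z$3)\<^sup>2"
        unfolding form using * by (simp add: field_simps power2_eq_square)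
      have nn: "0 \<le> a * (z$1 + p / a * z$3)\<^sup>2" "0 \<le> b * (z$2 + q / b * z$3)\<^sup>2"
        "0 \<le> (c - p\<^sup>2 / a - q\<^sup>2 / b) * (z$3)\<^sup>2"
        using * by auto
      have "z$1 \<noteq> 0 \<or> z$2 \<noteq> 0 \<or> z$3 \<noteq> 0"
        using that by (simp add: vec_eq_iff forall_3)
      then consider "z$3 \<noteq> 0" | "z$3 = 0" "z$1 \<noteq> 0" | "z$3 = 0" "z$2 \<noteq> 0" by blast
      then show ?thesis
      proof cases
        case 1
        then have "0 < (c - p\<^sup>2 / a - q\<^sup>2 / b) * (z$3)\<^sup>2" using * by simp
        with nn show ?thesis unfolding eq by linarith
      next
        case 2
        then have "0 < a * (z$1 + p / a * z$3)\<^sup>2" using * by simp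
        with nn show ?thesis unfolding eq by linarith
      next
        case 3
        then have "0 < b * (z$2 + q / b * z$3)\<^sup>2" using * by simp
        with nn show ?thesis unfolding eq by linarith
      qed
    qed
    then show "pos_def (vmat a b c p q)"
      unfolding pos_def_def using sym by blast
  qed
qed

lemma vmat_in_cone_iff:
  "vmat a b c p q \<in> \<Omega> \<longleftrightarrow> 0 < a \<and> 0 < b \<and> 0 < c - p\<^sup>2 / a - q\<^sup>2 / b"
  by (simp add: \<Omega>_def pos_def_vmat)

lemma cone_cases:
  assumes "x \<in> \<Omega>"
  obtains a b c p q where "x = vmat a b c p q" "0 < a" "0 < b" "0 < c - p\<^sup>2 / a - q\<^sup>2 / b"
  using assms by (metis (no_types, lifting) V_cases \<Omega>_def mem_Collect_eq vmat_in_cone_iff)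

lemma cholesky_vmat:
  assumes "0 < a" "0 < b" "0 < c - p\<^sup>2 / a - q\<^sup>2 / b"
  shows "cholesky (vmat a b c p q) =
    tri (sqrt a) (sqrt b) (sqrt (c - p\<^sup>2 / a - q\<^sup>2 / b)) (p / sqrt a) (q / sqrt b)"
  unfolding cholesky_def
proof (rule the_equality, goal_cases)
  case 1
  have s: "(sqrt a)\<^sup>2 = a" "(sqrt b)\<^sup>2 = b"
    "(sqrt (c - p\<^sup>2 / a - q\<^sup>2 / b))\<^sup>2 = c - p\<^sup>2 / a - q\<^sup>2 / b"
    using assms by simp_all
  show ?case
    using assms s
    by (auto simp: lower_triangular_def forall_3 mat3_mult_nth transpose_nth power_divide
        intro!: mat3_eqI simp flip: power2_eq_square)
next
  case (2 T)
  then have lt: "T$1$2 = 0" "T$1$3 = 0" "T$2$3 = 0"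
    and pos: "T$1$1 > 0" "T$2$2 > 0" "T$3$3 > 0"
    by (auto simp: lower_triangular_def)
  have ent: "vmat a b c p q $ i $ j = T$i$1 * T$j$1 + T$i$2 * T$j$2 + T$i$3 * T$j$3" for i j
    using 2 by (simp add: mat3_mult_nth transpose_nth)
  have t11: "T$1$1 = sqrt a"
    using ent[of 1 1] lt pos by (simp add: real_sqrt_unique power2_eq_square)
  \<comment> \<open>The zero pattern of \<open>V\<close> enters here: it keeps every lower
    triangular factor in the shape \<open>tri\<close>.\<close>
  have t21: "T$2$1 = 0"
    using ent[of 2 1] lt pos by simp
  have t22: "T$2$2 = sqrt b"
    using ent[of 2 2] lt pos t21 by (simp add: real_sqrt_unique power2_eq_square)
  have t31: "T$3$1 = p / sqrt a"
    using ent[of 3 1] lt pos t11 by (simp add: field_simps)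
  have t32: "T$3$2 = q / sqrt b"
    using ent[of 3 2] lt pos t21 t22 by (simp add: field_simps)
  have "(T$3$3)\<^sup>2 = c - (p / sqrt a)\<^sup>2 - (q / sqrt b)\<^sup>2"
    using ent[of 3 3] t31 t32 by (simp add: power2_eq_square)
  then have "(T$3$3)\<^sup>2 = c - p\<^sup>2 / a - q\<^sup>2 / b"
    using assms by (simp add: power_divide)
  then have t33: "T$3$3 = sqrt (c - p\<^sup>2 / a - q\<^sup>2 / b)"
    using pos by (metis order_less_imp_le real_sqrt_unique)
  show ?case
    by (intro mat3_eqI) (use lt t11 t21 t22 t31 t32 t33 in auto)
qed

section \<open>Exponential series of linear operators\<close>

lemma summable_op_exp:
  fixes F :: "'a \<Rightarrow> 'a::banach"
  assumes "bounded_linear F"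
  shows "summable (\<lambda>k. (1 / fact k) *\<^sub>R (F ^^ k) x)"
proof -
  obtain K where K: "K > 0" "\<And>x. norm (F x) \<le> norm x * K"
    using bounded_linear.pos_bounded[OF assms] by blast
  have bound: "norm ((F ^^ k) x) \<le> norm x * K ^ k" for k
  proof (induction k)
    case (Suc k)
    have "norm ((F ^^ Suc k) x) \<le> norm ((F ^^ k) x) * K"
      using K(2) by simp
    also have "\<dots> \<le> norm x * K ^ k * K"
      using Suc K(1) by (intro mult_right_mono) auto
    finally show ?case by (simp add: mult_ac)
  qed simp
  have "summable (\<lambda>k. norm x * (K ^ k /\<^sub>R fact k))"
    by (intro summable_mult summable_exp_generic)
  then show ?thesis
    by (rule summable_comparison_test'[where N = 0]) (use bound in \<open>simp add: field_simps\<close>)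
qed

lemma op_exp_sums:
  fixes F :: "'a \<Rightarrow> 'a::banach"
  assumes "bounded_linear F"
  shows "(\<lambda>k. (1 / fact k) *\<^sub>R (F ^^ k) x) sums op_exp F x"
  unfolding op_exp_def using summable_op_exp[OF assms] by (rule summable_sums)

text \<open>\<open>g\<close> carries the series of \<open>F\<close> term by term to that of
  \<open>G\<close>, convergence included. The relation is asked only on an
  \<open>F\<close>-invariant set \<open>S\<close>, which allows maps that are controlled on
  \<open>V\<close> alone.\<close>

lemma op_exp_intertwine:
  fixes F :: "'a \<Rightarrow> 'a::banach" and G :: "'b \<Rightarrow> 'b::real_normed_vector"
  assumes F: "bounded_linear F" and g: "bounded_linear g"
    and inv: "x \<in> S" "\<And>y. y \<in> S \<Longrightarrow> F y \<in> S"
    and comm: "\<And>y. y \<in> S \<Longrightarrow> g (F y) = G (g y)"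
  shows "g (op_exp F x) = op_exp G (g x)"
proof -
  have iter: "(F ^^ k) x \<in> S \<and> g ((F ^^ k) x) = (G ^^ k) (g x)" for k
    by (induction k) (auto simp: inv comm)
  have "(\<lambda>k. g ((1 / fact k) *\<^sub>R (F ^^ k) x)) sums g (op_exp F x)"
    using bounded_linear.sums[OF g op_exp_sums[OF F]] .
  then have "(\<lambda>k. (1 / fact k) *\<^sub>R (G ^^ k) (g x)) sums g (op_exp F x)"
    using iter by (simp add: linear_scale[OF bounded_linear.linear[OF g]])
  then show ?thesis
    unfolding op_exp_def by (rule sums_unique)
qed

lemma op_exp_linear:
  fixes F :: "'a \<Rightarrow> 'a::banach"
  assumes F: "bounded_linear F"
  shows "op_exp F (r *\<^sub>R x + s *\<^sub>R y) = r *\<^sub>R op_exp F x + s *\<^sub>R op_exp F y"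
proof -
  have iter: "(F ^^ k) (r *\<^sub>R x + s *\<^sub>R y) = r *\<^sub>R (F ^^ k) x + s *\<^sub>R (F ^^ k) y" for k
    by (induction k) (auto simp: linear_scale[OF bounded_linear.linear[OF F]] linear_add[OF bounded_linear.linear[OF F]])
  have "(\<lambda>k. r *\<^sub>R ((1 / fact k) *\<^sub>R (F ^^ k) x) + s *\<^sub>R ((1 / fact k) *\<^sub>R (F ^^ k) y))
    sums (r *\<^sub>R op_exp F x + s *\<^sub>R op_exp F y)"
    by (intro sums_add sums_scaleR_right op_exp_sums F)
  then have "(\<lambda>k. (1 / fact k) *\<^sub>R (F ^^ k) (r *\<^sub>R x + s *\<^sub>R y))
    sums (r *\<^sub>R op_exp F x + s *\<^sub>R op_exp F y)"
    unfolding iter by (simp add: scaleR_add_right mult.commute)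
  then show ?thesis
    unfolding op_exp_def[of F "r *\<^sub>R x + s *\<^sub>R y"] by (rule sums_unique[symmetric])
qed

lemma op_exp_mult:
  fixes \<mu> :: "'a::{real_normed_field, banach}"
  shows "op_exp ((*) \<mu>) 1 = exp \<mu>"
proof -
  have "((*) \<mu> ^^ k) 1 = \<mu> ^ k" for k
    by (induction k) auto
  then show ?thesis
    by (simp add: op_exp_def exp_def inverse_eq_divide)
qed

text \<open>The map sending s to \<open>s *\<^sub>R x\<close> intertwines multiplication by
  \<open>r\<close> on the reals with \<open>F\<close>.\<close>

lemma op_exp_eigenvector:
  fixes F :: "'a \<Rightarrow> 'a::banach"
  assumes F: "bounded_linear F" and x: "F x = r *\<^sub>R x"
  shows "op_exp F x = exp r *\<^sub>R x"
  using op_exp_intertwine[of "(*) r" "\<lambda>s. s *\<^sub>R x" 1 UNIV F] x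
  by (simp add: op_exp_mult bounded_linear_mult_right bounded_linear_scaleR_left
      linear_scale[OF bounded_linear.linear[OF F]] mult.commute)

text \<open>The first divided difference of exp.\<close>

definition dexp :: "real \<Rightarrow> real \<Rightarrow> real" where
  "dexp s t = (if s = t then exp s else (exp s - exp t) / (s - t))"

lemma dexp_pos: "dexp s t > 0"
  by (cases "s < t") (auto simp: dexp_def divide_neg_neg)

text \<open>On the span of \<open>x\<close> and \<open>y\<close> the operator acts as a triangular
  2x2 matrix; the off-diagonal entry of its exponential is a divided difference, also in the Jordan
  case \<open>r = s\<close>.\<close>

lemma op_exp_chain:
  fixes F :: "'a \<Rightarrow> 'a::banach"
  assumes F: "bounded_linear F" and x: "F x = r *\<^sub>R x + y" and y: "F y = s *\<^sub>R y"
  shows "op_exp F x = exp r *\<^sub>R x + dexp r s *\<^sub>R y"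
proof (cases "r = s")
  case False
  \<comment> \<open>This combination is the eigenvector for \<open>r\<close> that diagonalises the
    2x2 block.\<close>
  define z where "z = x + (1 / (r - s)) *\<^sub>R y"
  have c: "1 + s / (r - s) = r / (r - s)"
    using False by (simp add: field_simps)
  have "F z = r *\<^sub>R x + (1 + s / (r - s)) *\<^sub>R y"
    using x y by (simp add: z_def linear_add[OF bounded_linear.linear[OF F]] linear_scale[OF bounded_linear.linear[OF F]] algebra_simps)
  then have "F z = r *\<^sub>R z"
    unfolding c by (simp add: z_def scaleR_add_right)
  then have z: "op_exp F z = exp r *\<^sub>R z"
    by (rule op_exp_eigenvector[OF F])
  have "op_exp F x = op_exp F (1 *\<^sub>R z + (- 1 / (r - s)) *\<^sub>R y)"
    by (simp add: z_def)
  also have "\<dots> = exp r *\<^sub>R z + (- 1 / (r - s)) *\<^sub>R exp s *\<^sub>R y"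
    unfolding op_exp_linear[OF F] z op_exp_eigenvector[OF F y] by simp
  also have "\<dots> = exp r *\<^sub>R x + ((exp r - exp s) / (r - s)) *\<^sub>R y"
    by (simp add: z_def scaleR_add_right diff_divide_distrib scaleR_diff_left)
  finally show ?thesis
    using False by (simp add: dexp_def)
next
  case True
  \<comment> \<open>At k = 0 the truncated exponent \<open>k - 1\<close> is harmless, since its
    factor \<open>real k\<close> vanishes.\<close>
  have iter: "(F ^^ k) x = r ^ k *\<^sub>R x + (real k * r ^ (k - 1)) *\<^sub>R y" for k
  proof (induction k)
    case (Suc k)
    have "r * (real k * r ^ (k - 1)) = real k * r ^ k"
      by (cases k) auto
    then show ?case
      using x y True Suc
      by (simp add: linear_add[OF bounded_linear.linear[OF F]] linear_scale[OF bounded_linear.linear[OF F]] algebra_simps)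
  qed simp
  have e: "(\<lambda>k. (1 / fact k) * r ^ k) sums exp r"
    using exp_converges[of r] by (simp add: inverse_eq_divide)
  \<comment> \<open>Cancelling k + 1 against the factorial gives back the exponential series; the
    term of index 0 restored afterwards is zero.\<close>
  have "(\<lambda>k. (1 / fact (Suc k)) * (real (Suc k) * r ^ (Suc k - 1))) sums exp r"
    using e by (simp add: fact_Suc divide_simps del: of_nat_Suc)
  then have "(\<lambda>k. (1 / fact k) * (real k * r ^ (k - 1))) sums (exp r + (1 / fact 0) * (real 0 * r ^ (0 - 1)))"
    by (subst (asm) sums_Suc_iff) simp
  then have e': "(\<lambda>k. (1 / fact k) * (real k * r ^ (k - 1))) sums exp r"
    by simp
  have "(\<lambda>k. ((1 / fact k) * r ^ k) *\<^sub>R x + ((1 / fact k) * (real k * r ^ (k - 1))) *\<^sub>R y)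
      sums (exp r *\<^sub>R x + exp r *\<^sub>R y)"
    by (intro sums_add sums_scaleR_left e e')
  then have "(\<lambda>k. (1 / fact k) *\<^sub>R (F ^^ k) x) sums (exp r *\<^sub>R x + exp r *\<^sub>R y)"
    unfolding iter by (simp add: scaleR_add_right)
  then show ?thesis
    using True op_exp_sums[OF F, of x] by (simp add: dexp_def sums_unique2)
qed

section \<open>Uniqueness of the principal logarithm\<close>

text \<open>Cayley-Hamilton applied to a vector; the middle coefficient is the sum of the principal
  2x2 minors.\<close>

lemma cayley_hamilton_3:
  fixes N :: "'a::comm_ring_1^3^3"
  shows "N *v (N *v (N *v y)) = (N$1$1 + N$2$2 + N$3$3) *s (N *v (N *v y)) -
    (N$1$1 * N$2$2 - N$1$2 * N$2$1 + N$1$1 * N$3$3 - N$1$3 * N$3$1 + N$2$2 * N$3$3 - N$2$3 * N$3$2)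
      *s (N *v y) + det N *s y"
  by (simp add: vec_eq_iff forall_3 matrix_vector_mult_def sum_3 det_3 algebra_simps)

text \<open>The characteristic polynomial splits over the complex numbers; inserting its roots into
  Cayley-Hamilton factors the identity.\<close>

lemma complex_mat3_split:
  fixes N :: "complex^3^3"
  defines "R \<equiv> \<lambda>s y. N *v y - s *s y"
  obtains a b c where "\<And>y. R a (R b (R c y)) = 0"
proof -
  let ?m = "N$1$1 * N$2$2 - N$1$2 * N$2$1 + N$1$1 * N$3$3 - N$1$3 * N$3$1
    + N$2$2 * N$3$3 - N$2$3 * N$3$2"
  define p where "p = [:- det N, ?m, - (N$1$1 + N$2$2 + N$3$3), 1:]"
  have deg: "degree p = 3" "lead_coeff p = 1"
    by (simp_all add: p_def)
  then have "p \<noteq> 0" by auto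
  from alg_closed_imp_factorization[OF this] deg
  obtain M where M: "size M = 3" "p = (\<Prod>x\<in>#M. [:-x, 1:])" by auto
  obtain c M2 where "M = add_mset c M2" "size M2 = 2"
    using M(1) size_eq_Suc_imp_eq_union[of M 2] by auto
  moreover then obtain b M1 where "M2 = add_mset b M1" "size M1 = 1"
    using size_eq_Suc_imp_eq_union[of M2 1] by auto
  moreover then obtain a where "M1 = {#a#}"
    using size_1_singleton_mset by blast
  ultimately have "p = [:-c, 1:] * ([:-b, 1:] * [:-a, 1:])"
    using M(2) by simp
  then have roots: "det N = a * b * c" "N$1$1 + N$2$2 + N$3$3 = a + b + c"
    "?m = a * b + a * c + b * c"
    by (auto simp: p_def algebra_simps)
  have "R a (R b (R c y)) = 0" for y
    unfolding R_def
    by (simp add: matrix_vector_mult_diff_distrib vector_scalar_commute cayley_hamilton_3[of N y, unfolded roots]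
        vec_eq_iff algebra_simps)
  then show thesis by (rule that)
qed

text \<open>Apply the three factors of the split cubic to \<open>y\<close> one after another: the
  last nonzero vector is an eigenvector, and closure keeps it in \<open>S\<close>.\<close>

lemma invariant_set_eigenvector:
  fixes N :: "complex^3^3"
  assumes "y \<in> S" "y \<noteq> 0" and inv: "\<And>z s. z \<in> S \<Longrightarrow> N *v z - s *s z \<in> S"
  obtains \<mu> v where "v \<in> S" "v \<noteq> 0" "N *v v = \<mu> *s v"
proof -
  obtain a b c where *: "N *v (N *v (N *v y - c *s y) - b *s (N *v y - c *s y)) -
      a *s (N *v (N *v y - c *s y) - b *s (N *v y - c *s y)) = 0"
    using complex_mat3_split[of N] by blast
  define z where "z = N *v y - c *s y"
  define w where "w = N *v z - b *s z"
  have "z \<in> S"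
    using assms(1) inv by (simp add: z_def)
  moreover from this have "w \<in> S"
    using inv unfolding w_def by blast
  ultimately have S: "z \<in> S" "w \<in> S" .
  have w: "N *v w = a *s w"
    using * by (simp add: w_def z_def)
  show thesis
  proof (cases "z = 0 \<or> w = 0")
    case True
    then show thesis
      using that[OF assms(1,2), of c] that[OF S(1), of b]
      by (auto simp: z_def w_def)
  qed (use that S w in blast)
qed

text \<open>Evaluation at \<open>z\<close> intertwines left multiplication by \<open>A\<close> with
  the action of \<open>A\<close> on vectors. Using \<open>of_real\<close> covers real and complex
  vectors at once.\<close>

lemma mat_exp_mult_vec:
  "map_matrix of_real (mat_exp A) *v (z :: ('a::{real_algebra_1,euclidean_space})^3)
     = op_exp ((*v) (map_matrix of_real A)) z"
proof -
  let ?g = "\<lambda>X :: mat3. map_matrix of_real X *v z"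
  have g: "bounded_linear ?g"
    unfolding linear_conv_bounded_linear[symmetric]
    by (intro linearI)
      (simp_all add: vec_eq_iff matrix_vector_mult_def map_matrix_def sum.distrib
        algebra_simps scaleR_sum_right scaleR_conv_of_real[symmetric] of_real_def)
  have F: "bounded_linear (\<lambda>X :: mat3. A ** X)"
    unfolding linear_conv_bounded_linear[symmetric]
    by (intro linearI) (simp_all add: matrix_add_ldistrib matrix_scalar_ac scalar_matrix_assoc)
  have comm: "?g (A ** X) = map_matrix of_real A *v ?g X" for X
    unfolding matrix_vector_mul_assoc
    by (simp add: vec_eq_iff matrix_matrix_mult_def map_matrix_def matrix_vector_mult_def)
  have "map_matrix of_real (mat 1 :: mat3) = (mat 1 :: 'a^3^3)"
    by (simp add: vec_eq_iff mat_def)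
  then have one: "?g (mat 1) = z"
    by simp
  show ?thesis
    unfolding mat_exp_def
    using op_exp_intertwine[OF F g, of "mat 1" UNIV "(*v) (map_matrix of_real A)"] comm one
    by simp
qed

lemma mat_exp_mult_real_vec: "mat_exp A *v z = op_exp ((*v) A) z"
proof -
  have "map_matrix of_real B = B" for B :: mat3
    by (simp add: vec_eq_iff)
  then show ?thesis
    using mat_exp_mult_vec[of A z] by simp
qed

text \<open>Complex counterpart of \<open>op_exp_eigenvector\<close>, whose eigenvalue is a real
  scalar.\<close>

lemma op_exp_complex_eigenvector:
  fixes C :: "complex^3^3"
  assumes "C *v z = \<mu> *s z"
  shows "op_exp ((*v) C) z = exp \<mu> *s z"
proof -
  have "bounded_linear (\<lambda>c. c *s z)"
    unfolding linear_conv_bounded_linear[symmetric]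
    by (intro linearI) (simp_all add: vec_eq_iff algebra_simps)
  moreover have "(\<mu> * y) *s z = C *v (y *s z)" for y
    using assms by (simp add: vector_scalar_commute vector_smult_assoc mult.commute)
  ultimately show ?thesis
    using op_exp_intertwine[OF bounded_linear_mult_right[of \<mu>], of "\<lambda>c. c *s z" 1 UNIV "(*v) C"]
    by (simp add: op_exp_mult)
qed

text \<open>On the eigenspace \<open>E\<close> of \<open>exp X\<close> for \<open>a\<close>, the range of \<open>X - ln a\<close> is invariant. If it were nonzero
  it would contain an eigenvector \<open>v = (X - ln a) x\<close>; the strip condition makes its eigenvalue \<open>ln a\<close>,
  so \<open>x, v\<close> is a Jordan chain and \<open>exp X x = a x + a v\<close>, which contradicts \<open>x \<in> E\<close>.\<close>

lemma principal_log_eigenvector: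
  assumes strip: "\<And>\<mu>. complex_eigenvalue X \<mu> \<Longrightarrow> \<bar>Im \<mu>\<bar> < pi"
    and w: "mat_exp X *v w = a *s w" and a: "a > 0"
  shows "X *v w = ln a *s w"
proof (rule ccontr)
  assume neq: "X *v w \<noteq> ln a *s w"
  define C where "C = map_matrix complex_of_real X"
  define E where "E = {z. op_exp ((*v) C) z = a *\<^sub>R z}"
  have bl: "bounded_linear ((*v) C)" by simp
  \<comment> \<open>\<open>C - s\<close> commutes with \<open>C\<close>, hence with its exponential,
    so it preserves the eigenspaces of the latter.\<close>
  have E_inv: "C *v z - s *s z \<in> E" if "z \<in> E" for z s
  proof -
    have bl': "bounded_linear (\<lambda>z. C *v z - s *s z)"
      unfolding linear_conv_bounded_linear[symmetric]
      by (intro linearI) (simp_all add: vec_eq_iff matrix_vector_mult_def sum.distrib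
          scaleR_sum_right algebra_simps)
    have "op_exp ((*v) C) (C *v z - s *s z) = C *v op_exp ((*v) C) z - s *s op_exp ((*v) C) z"
      by (rule op_exp_intertwine[OF bl bl', where S = UNIV, symmetric])
        (simp_all add: matrix_vector_mult_diff_distrib vector_scalar_commute)
    also have "\<dots> = a *\<^sub>R (C *v z - s *s z)"
      using that linear_scale[OF bounded_linear.linear[OF bl'], of a z] by (simp add: E_def)
    finally show ?thesis by (simp add: E_def)
  qed
  define S where "S = (\<lambda>z. C *v z - complex_of_real (ln a) *s z) ` E"
  have S_inv: "C *v z - s *s z \<in> S" if "z \<in> S" for z s
  proof -
    from that obtain x where x: "x \<in> E" "z = C *v x - complex_of_real (ln a) *s x"
      by (auto simp: S_def)
    have "C *v z - s *s z = C *v (C *v x - s *s x) - complex_of_real (ln a) *s (C *v x - s *s x)"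
      unfolding x(2)
      by (simp add: matrix_vector_mult_diff_distrib vector_scalar_commute vec_eq_iff algebra_simps)
    then show ?thesis
      unfolding S_def by (rule image_eqI[OF _ E_inv[OF x(1)]])
  qed
  \<comment> \<open>The strip condition speaks of complex eigenvalues, so the real vector is
    complexified.\<close>
  define w' where "w' = (\<chi> i. complex_of_real (w $ i))"
  have of_real_vec: "map_matrix complex_of_real M *v w' = (\<chi> i. complex_of_real ((M *v w) $ i))" for M
    by (simp add: w'_def vec_eq_iff matrix_vector_mult_def)
  have scale: "complex_of_real r *s y = r *\<^sub>R y" for r and y :: "complex^3"
    by (simp add: vec_eq_iff) (simp add: scaleR_conv_of_real)
  have "op_exp ((*v) C) w' = complex_of_real a *s w'"
    unfolding C_def mat_exp_mult_vec[symmetric] of_real_vec w by (simp add: w'_def vec_eq_iff)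
  then have "w' \<in> E"
    by (simp add: E_def scale)
  then have "C *v w' - complex_of_real (ln a) *s w' \<in> S"
    unfolding S_def by blast
  moreover have "C *v w' - complex_of_real (ln a) *s w' \<noteq> 0"
    using neq of_real_vec[of X] by (simp add: C_def w'_def vec_eq_iff flip: of_real_mult)
  ultimately obtain \<mu> v where v: "v \<in> S" "v \<noteq> 0" "C *v v = \<mu> *s v"
    using S_inv by (rule invariant_set_eigenvector)
  then obtain x where x: "x \<in> E" "v = C *v x - complex_of_real (ln a) *s x"
    by (auto simp: S_def)
  have "op_exp ((*v) C) v = a *\<^sub>R v"
    using E_inv[OF x(1)] x(2) by (simp add: E_def)
  then have "exp \<mu> *s v = complex_of_real a *s v"
    using op_exp_complex_eigenvector[OF v(3)] by (simp add: scale)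
  then have "exp \<mu> = complex_of_real a"
    using v(2) vec.scale_right_imp_eq by blast
  moreover have "\<bar>Im \<mu>\<bar> < pi"
    using strip v(2,3) by (auto simp: complex_eigenvalue_def C_def)
  \<comment> \<open>On the strip |Im| < pi the principal branch \<open>Ln\<close> inverts
    \<open>exp\<close>.\<close>
  ultimately have \<mu>: "\<mu> = complex_of_real (ln a)"
    using Ln_exp[of \<mu>] Ln_of_real[OF a] by auto
  have "op_exp ((*v) C) x = exp (ln a) *\<^sub>R x + dexp (ln a) (ln a) *\<^sub>R v"
  proof (rule op_exp_chain[OF bl])
    show "C *v x = ln a *\<^sub>R x + v"
      using x(2) by (simp add: scale)
    show "C *v v = ln a *\<^sub>R v"
      using v(3) by (simp add: \<mu> scale)
  qed
  then show False
    using x(1) v(2) a by (simp add: E_def dexp_def)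
qed

section \<open>The explicit logarithm on the cone\<close>

text \<open>Both spectra are the zeros of the same determinant. This passes the strip condition to
  the transpose, so that left eigenvectors can be handled too.\<close>

lemma complex_eigenvalue_transpose:
  "complex_eigenvalue (transpose A) \<mu> \<longleftrightarrow> complex_eigenvalue A \<mu>"
proof -
  have *: "complex_eigenvalue B \<mu> \<longleftrightarrow> det (map_matrix complex_of_real B - mat \<mu>) = 0" for B
  proof -
    have "mat \<mu> *v z = \<mu> *s z" for z :: "complex^3"
      by (simp add: vec_eq_iff matrix_vector_mult_def mat_def if_distrib[where f = "\<lambda>x. x * _"]
          cong: if_cong)
    then have "complex_eigenvalue B \<mu> \<longleftrightarrow> (\<exists>z. z \<noteq> 0 \<and> (map_matrix complex_of_real B - mat \<mu>) *v z = 0)"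
      by (simp add: complex_eigenvalue_def matrix_vector_mult_diff_rdistrib)
    also have "\<dots> \<longleftrightarrow> \<not> invertible (map_matrix complex_of_real B - mat \<mu>)"
      using matrix_left_invertible_ker invertible_left_inverse by blast
    finally show ?thesis
      by (simp add: invertible_det_nz)
  qed
  have "map_matrix complex_of_real (transpose A) - mat \<mu>
      = transpose (map_matrix complex_of_real A - mat \<mu>)"
    by (simp add: vec_eq_iff transpose_def mat_def)
  then show ?thesis
    by (simp add: * det_transpose)
qed

lemma mat_exp_transpose: "mat_exp (transpose A) = transpose (mat_exp A)"
proof -
  have F: "bounded_linear (\<lambda>X :: mat3. B ** X)" for B
    unfolding linear_conv_bounded_linear[symmetric]
    by (intro linearI) (simp_all add: matrix_add_ldistrib matrix_scalar_ac scalar_matrix_assoc)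
  have t: "bounded_linear (transpose :: mat3 \<Rightarrow> mat3)"
    unfolding linear_conv_bounded_linear[symmetric]
    by (intro linearI) (simp_all add: vec_eq_iff transpose_def)
  \<comment> \<open>Transposition turns left into right multiplication; powers of \<open>B\<close>
    commute with \<open>B\<close>, which moves the factor back.\<close>
  have commute: "((**) B ^^ k) (mat 1) ** B = B ** ((**) B ^^ k) (mat 1)" for k and B :: mat3
    by (induction k) (simp_all flip: matrix_mul_assoc)
  have "transpose (((**) A ^^ k) (mat 1)) = ((**) (transpose A) ^^ k) (mat 1)" for k
    by (induction k) (simp_all add: transpose_mat matrix_transpose_mul commute)
  moreover have "(\<lambda>k. transpose ((1 / fact k) *\<^sub>R ((**) A ^^ k) (mat 1))) sums transpose (mat_exp A)"
    unfolding mat_exp_def by (intro bounded_linear.sums[OF t] op_exp_sums F)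
  ultimately have "(\<lambda>k. (1 / fact k) *\<^sub>R ((**) (transpose A) ^^ k) (mat 1)) sums transpose (mat_exp A)"
    by (simp add: linear_scale[OF bounded_linear.linear[OF t]])
  then show ?thesis
    unfolding mat_exp_def[of "transpose A"] op_exp_def by (rule sums_unique[symmetric])
qed

lemma mat3_mult_vec: "A *v z = vector [A$1$1 * z$1 + A$1$2 * z$2 + A$1$3 * z$3,
    A$2$1 * z$1 + A$2$2 * z$2 + A$2$3 * z$3, A$3$1 * z$1 + A$3$2 * z$2 + A$3$3 * z$3]"
  for A :: "'a::comm_semiring_1^3^3"
  by (simp add: vec_eq_iff forall_3 matrix_vector_mult_def sum_3)

text \<open>Column by column: the third basis vector is an eigenvector for \<open>c\<close>, and
  each of the first two starts a chain of length two ending in a multiple of it.\<close>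

lemma mat_exp_tri:
  "mat_exp (tri a b c p q) = tri (exp a) (exp b) (exp c) (dexp a c * p) (dexp b c * q)"
proof -
  let ?A = "tri a b c p q"
  have bl: "bounded_linear ((*v) ?A)" by simp
  have y: "?A *v vector [0, 0, s] = c *\<^sub>R vector [0, 0, s]" for s
    by (simp add: mat3_mult_vec vec_eq_iff forall_3)
  have 1: "op_exp ((*v) ?A) (vector [1, 0, 0]) =
      exp a *\<^sub>R vector [1, 0, 0] + dexp a c *\<^sub>R vector [0, 0, p]"
    by (rule op_exp_chain[OF bl _ y]) (simp add: mat3_mult_vec vec_eq_iff forall_3)
  have 2: "op_exp ((*v) ?A) (vector [0, 1, 0]) =
      exp b *\<^sub>R vector [0, 1, 0] + dexp b c *\<^sub>R vector [0, 0, q]"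
    by (rule op_exp_chain[OF bl _ y]) (simp add: mat3_mult_vec vec_eq_iff forall_3)
  have 3: "op_exp ((*v) ?A) (vector [0, 0, 1]) = exp c *\<^sub>R vector [0, 0, 1]"
    by (rule op_exp_eigenvector[OF bl y])
  show ?thesis
    using 1 2 3 unfolding mat_exp_mult_real_vec[symmetric]
    by (intro mat3_eqI) (simp_all add: mat3_mult_vec vec_eq_iff forall_3)
qed

lemma complex_eigenvalue_tri:
  assumes "complex_eigenvalue (tri a b c p q) \<mu>"
  shows "Im \<mu> = 0"
proof -
  obtain z where z: "z \<noteq> 0" "map_matrix complex_of_real (tri a b c p q) *v z = \<mu> *s z"
    using assms by (auto simp: complex_eigenvalue_def)
  then have *: "a * z$1 = \<mu> * z$1" "b * z$2 = \<mu> * z$2" "p * z$1 + q * z$2 + c * z$3 = \<mu> * z$3"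
    by (simp_all add: mat3_mult_vec vec_eq_iff forall_3)
  have "z$1 \<noteq> 0 \<or> z$2 \<noteq> 0 \<or> z$3 \<noteq> 0"
    using z(1) by (simp add: vec_eq_iff forall_3)
  then have "\<mu> = a \<or> \<mu> = b \<or> \<mu> = c"
    using * by auto
  then show ?thesis by auto
qed

text \<open>The third basis vector is a right eigenvector of the given matrix, the first two are
  left eigenvectors. Any admissible \<open>X\<close> inherits all three, which fixes its last column
  and first two rows; the two remaining entries follow by comparison with
  \<open>mat_exp_tri\<close>.\<close>

lemma mat_log_tri:
  assumes pos: "a > 0" "b > 0" "c > 0"
  shows "mat_log (tri a b c p q) =
    tri (ln a) (ln b) (ln c) (p / dexp (ln a) (ln c)) (q / dexp (ln b) (ln c))"
  unfolding mat_log_def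
proof (rule the_equality, goal_cases)
  case 1
  show ?case
    using pos dexp_pos by (auto simp: mat_exp_tri complex_eigenvalue_tri less_imp_neq[symmetric])
next
  case (2 X)
  then have X: "mat_exp X = tri a b c p q"
    and strip: "\<And>\<mu>. complex_eigenvalue X \<mu> \<Longrightarrow> \<bar>Im \<mu>\<bar> < pi" by blast+
  have 3: "X *v vector [0, 0, 1] = ln c *s vector [0, 0, 1]"
    by (rule principal_log_eigenvector[OF strip]) (use X pos in \<open>simp_all add: mat3_mult_vec vec_eq_iff forall_3\<close>)
  have strip': "\<bar>Im \<mu>\<bar> < pi" if "complex_eigenvalue (transpose X) \<mu>" for \<mu>
    using that strip complex_eigenvalue_transpose by blast
  have 1: "transpose X *v vector [1, 0, 0] = ln a *s vector [1, 0, 0]"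
    by (rule principal_log_eigenvector[OF strip'])
      (use X pos in \<open>simp_all add: mat_exp_transpose mat3_mult_vec vec_eq_iff forall_3 transpose_nth\<close>)
  have 2: "transpose X *v vector [0, 1, 0] = ln b *s vector [0, 1, 0]"
    by (rule principal_log_eigenvector[OF strip'])
      (use X pos in \<open>simp_all add: mat_exp_transpose mat3_mult_vec vec_eq_iff forall_3 transpose_nth\<close>)
  have shape: "X = tri (ln a) (ln b) (ln c) (X$3$1) (X$3$2)"
    using 1 2 3 by (intro mat3_eqI) (simp_all add: mat3_mult_vec vec_eq_iff forall_3 transpose_nth)
  have "mat_exp (tri (ln a) (ln b) (ln c) (X$3$1) (X$3$2)) = tri a b c p q"
    using X shape by simp
  then have "p = dexp (ln a) (ln c) * X$3$1" "q = dexp (ln b) (ln c) * X$3$2"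
    unfolding mat_exp_tri by (metis tri_nth)+
  then show ?case
    using dexp_pos by (subst shape) (simp add: less_imp_neq[symmetric])
qed

text \<open>\<open>s\<close>, \<open>t\<close>, \<open>u\<close> are the logarithms of the Cholesky
  diagonal. They depend only on \<open>a\<close>, \<open>b\<close> and the Schur complement, so
  \<open>p\<close> and \<open>q\<close> otherwise occur linearly.\<close>

lemma Log_vmat:
  assumes pos: "0 < a" "0 < b" "0 < c - p\<^sup>2 / a - q\<^sup>2 / b"
  shows "Log (vmat a b c p q) = (let s = ln a / 2; t = ln b / 2; u = ln (c - p\<^sup>2 / a - q\<^sup>2 / b) / 2
    in vmat (2 * s) (2 * t) (2 * u) (p / (exp s * dexp s u)) (q / (exp t * dexp t u)))"
proof -
  define d where "d = c - p\<^sup>2 / a - q\<^sup>2 / b"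
  have d: "d > 0" using pos by (simp add: d_def)
  have exp_half: "exp (ln r / 2) = sqrt r" if "r > 0" for r
    using that unfolding ln_sqrt[OF less_imp_le[OF that], symmetric] by (intro exp_ln) simp
  have "mat_log (cholesky (vmat a b c p q)) = tri (ln a / 2) (ln b / 2) (ln d / 2)
      (p / sqrt a / dexp (ln a / 2) (ln d / 2)) (q / sqrt b / dexp (ln b / 2) (ln d / 2))"
    unfolding cholesky_vmat[OF pos] d_def[symmetric]
    using pos d by (simp add: mat_log_tri ln_sqrt)
  then show ?thesis
    unfolding Log_def Let_def d_def[symmetric]
    using pos by (intro mat3_eqI) (simp_all add: transpose_nth exp_half)
qed

section \<open>Trace, derivatives and automorphisms\<close>

text \<open>Composition with this projection turns a map that is linear on \<open>V\<close> only
  into a linear map on all matrices.\<close>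

definition V_proj :: "mat3 \<Rightarrow> mat3" where
  "V_proj x = vmat (x$1$1) (x$2$2) (x$3$3) (x$1$3) (x$2$3)"

lemma V_proj_in_V [simp]: "V_proj x \<in> V"
  by (simp add: V_proj_def)

lemma V_proj_eq: "x \<in> V \<Longrightarrow> V_proj x = x"
  unfolding V_proj_def by (rule V_eq_vmat[symmetric])

lemma linear_V_proj: "linear V_proj"
  by (intro linearI) (simp_all add: V_proj_def)

text \<open>This frees the trace from the basis picked by \<open>SOME\<close>. The argument is
  tr(AB) = tr(BA): expand \<open>f b\<close> through \<open>\<phi>\<close> and \<open>w\<close>,
  exchange the sums, and reassemble \<open>f (w j)\<close> from the basis.\<close>

lemma trace_on_eq_sum_coordinates:
  fixes f :: "'a::euclidean_space \<Rightarrow> 'a" and \<phi> :: "'i \<Rightarrow> 'a \<Rightarrow> real"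
  assumes S: "subspace S" and f: "linear f" "\<And>x. x \<in> S \<Longrightarrow> f x \<in> S"
    and w: "\<And>j. j \<in> J \<Longrightarrow> w j \<in> S" and \<phi>: "\<And>j. j \<in> J \<Longrightarrow> linear (\<phi> j)"
    and coord: "\<And>x. x \<in> S \<Longrightarrow> x = (\<Sum>j\<in>J. \<phi> j x *\<^sub>R w j)"
  shows "trace_on S f = (\<Sum>j\<in>J. \<phi> j (f (w j)))"
proof -
  define B where "B = (SOME B. B \<subseteq> S \<and> independent B \<and> span B = S)"
  have "\<exists>B. B \<subseteq> S \<and> independent B \<and> span B = S"
    by (metis basis_exists span_subspace S)
  then have "B \<subseteq> S \<and> independent B \<and> span B = S"
    unfolding B_def by (rule someI_ex)
  then have B: "B \<subseteq> S" "independent B" "span B = S" by blast+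
  have fin: "finite B"
    using B(2) by (rule independent_imp_finite)
  have rep: "representation B (f b) b = (\<Sum>j\<in>J. \<phi> j b * representation B (f (w j)) b)" if "b \<in> B" for b
  proof -
    have "f b = f (\<Sum>j\<in>J. \<phi> j b *\<^sub>R w j)"
      using coord that B(1) by auto
    also have "\<dots> = (\<Sum>j\<in>J. \<phi> j b *\<^sub>R f (w j))"
      by (simp add: linear_sum[OF f(1)] linear_scale[OF f(1)])
    finally have "f b = (\<Sum>j\<in>J. \<phi> j b *\<^sub>R f (w j))" .
    moreover have "\<phi> j b *\<^sub>R f (w j) \<in> span B" "f (w j) \<in> span B" if "j \<in> J" for j
      using w[OF that] f(2) B(3) S by (auto intro: subspace_scale)
    ultimately show ?thesis
      by (simp add: representation_sum[OF B(2)] representation_scale[OF B(2)])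
  qed
  have "(\<Sum>b\<in>B. representation B (f b) b) = (\<Sum>b\<in>B. \<Sum>j\<in>J. \<phi> j b * representation B (f (w j)) b)"
    using rep by simp
  also have "\<dots> = (\<Sum>j\<in>J. \<Sum>b\<in>B. \<phi> j b * representation B (f (w j)) b)"
    by (rule sum.swap)
  also have "\<dots> = (\<Sum>j\<in>J. \<phi> j (f (w j)))"
  proof (rule sum.cong)
    fix j assume j: "j \<in> J"
    have "f (w j) = (\<Sum>b\<in>B. representation B (f (w j)) b *\<^sub>R b)"
      using w[OF j] f(2) B fin by (simp add: sum_representation_eq)
    then have "\<phi> j (f (w j)) = \<phi> j (\<Sum>b\<in>B. representation B (f (w j)) b *\<^sub>R b)"
      by simp
    then show "(\<Sum>b\<in>B. \<phi> j b * representation B (f (w j)) b) = \<phi> j (f (w j))"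
      by (simp add: linear_sum[OF \<phi>[OF j]] linear_scale[OF \<phi>[OF j]] mult.commute)
  qed simp
  finally show ?thesis
    by (simp add: trace_on_def B_def)
qed

lemma linear_L: "linear (L u)"
  unfolding L_def clan_prod_def
  by (intro linearI)
    (simp_all add: vec_eq_iff forall_3 mat3_mult_nth algebra_simps)

text \<open>The diagonal coefficients of the operator in the coordinate basis are a, b, c, (a + c)/2
  and (b + c)/2.\<close>

lemma trace_on_V_L: "trace_on V (L (vmat a b c p q)) = 3 / 2 * a + 3 / 2 * b + 2 * c"
proof -
  define \<phi> where "\<phi> j x = [x$1$1, x$2$2, x$3$3, x$1$3, x$2$3] ! j" for j and x :: mat3
  define w where "w j = [vmat 1 0 0 0 0, vmat 0 1 0 0 0, vmat 0 0 1 0 0, vmat 0 0 0 1 0,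
    vmat 0 0 0 0 1] ! j" for j
  have J: "{..<5} = {0, 1, 2, 3, 4::nat}" by auto
  have "trace_on V (L (vmat a b c p q)) = (\<Sum>j<5. \<phi> j (L (vmat a b c p q) (w j)))"
  proof (rule trace_on_eq_sum_coordinates[OF subspace_V linear_L])
    show "L (vmat a b c p q) x \<in> V" if "x \<in> V" for x
      using that by (simp add: L_def)
    show "w j \<in> V" "linear (\<phi> j)" if "j \<in> {..<5}" for j
      using that by (auto simp: J w_def \<phi>_def intro!: linearI)
    show "x = (\<Sum>j<5. \<phi> j x *\<^sub>R w j)" if "x \<in> V" for x
      by (subst V_eq_vmat[OF that]) (simp add: J \<phi>_def w_def)
  qed
  then show ?thesis
    by (simp add: J \<phi>_def w_def L_def clan_prod_vmat field_simps)
qed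

section \<open>Differential calculus within the cone\<close>

lemma cone_subset_V: "\<Omega> \<subseteq> V"
  by (auto simp: \<Omega>_def)

lemma cone_open_in_directions:
  assumes x: "x \<in> \<Omega>" and u: "u \<in> V"
  obtains d where "d > 0" "\<And>t. \<bar>t\<bar> < d \<Longrightarrow> x + t *\<^sub>R u \<in> \<Omega>"
proof -
  from x obtain a b c p q where x_eq: "x = vmat a b c p q"
    and pos: "0 < a" "0 < b" "0 < c - p\<^sup>2 / a - q\<^sup>2 / b"
    by (rule cone_cases)
  from u obtain a' b' c' p' q' where u_eq: "u = vmat a' b' c' p' q'"
    by (rule V_cases)
  have lim: "((\<lambda>t. a + t * a') \<longlongrightarrow> a) (at 0)" "((\<lambda>t. b + t * b') \<longlongrightarrow> b) (at 0)"
    "((\<lambda>t. (c + t * c') - (p + t * p')\<^sup>2 / (a + t * a') - (q + t * q')\<^sup>2 / (b + t * b'))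
      \<longlongrightarrow> c - p\<^sup>2 / a - q\<^sup>2 / b) (at 0)"
    using pos by (auto intro!: tendsto_eq_intros)
  have "\<forall>\<^sub>F t in at 0. x + t *\<^sub>R u \<in> \<Omega>"
    unfolding x_eq u_eq vmat_scaleR vmat_add vmat_in_cone_iff
    by (intro eventually_conj order_tendstoD(1)[OF lim(1) pos(1)]
        order_tendstoD(1)[OF lim(2) pos(2)] order_tendstoD(1)[OF lim(3) pos(3)])
  then obtain d where "d > 0" "\<And>t. t \<noteq> 0 \<Longrightarrow> dist t 0 < d \<Longrightarrow> x + t *\<^sub>R u \<in> \<Omega>"
    unfolding eventually_at by auto
  then have "x + t *\<^sub>R u \<in> \<Omega>" if "\<bar>t\<bar> < d" for t
    using that x by (cases "t = 0") auto
  with \<open>d > 0\<close> show thesis by (rule that)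
qed

text \<open>Restricting to a short segment through \<open>x\<close> in direction \<open>u\<close>
  reduces the claim to uniqueness of derivatives in one real variable.\<close>

lemma cone_derivative_unique:
  assumes x: "x \<in> \<Omega>" and u: "u \<in> V"
    and A: "(f has_derivative A) (at x within \<Omega>)" and B: "(f has_derivative B) (at x within \<Omega>)"
  shows "A u = B u"
proof -
  from cone_open_in_directions[OF x u] obtain d
    where d: "d > 0" "\<And>t. \<bar>t\<bar> < d \<Longrightarrow> x + t *\<^sub>R u \<in> \<Omega>" by blast
  let ?l = "\<lambda>t. x + t *\<^sub>R u"
  have l: "(?l has_derivative (\<lambda>t. t *\<^sub>R u)) (at 0 within {-d<..<d})"
    by (auto intro!: derivative_eq_intros)
  have at_0: "at (0::real) within {-d<..<d} = at 0"
    using d(1) by (intro at_within_open) auto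
  have sub: "?l ` {-d<..<d} \<subseteq> \<Omega>"
    using d by auto
  have "(f \<circ> ?l has_derivative D \<circ> (\<lambda>t. t *\<^sub>R u)) (at 0)"
    if "(f has_derivative D) (at x within \<Omega>)" for D
  proof -
    have "(f has_derivative D) (at (?l 0) within ?l ` {-d<..<d})"
      using has_derivative_subset[OF that sub] by simp
    from diff_chain_within[OF l this] show ?thesis
      unfolding at_0 .
  qed
  from has_derivative_unique[OF this[OF A] this[OF B]]
  have "(A \<circ> (\<lambda>t. t *\<^sub>R u)) 1 = (B \<circ> (\<lambda>t. t *\<^sub>R u)) 1"
    by (rule fun_cong)
  then show ?thesis by simp
qed

text \<open>\<open>frechet_derivative\<close> is a choice among possible differentials; on
  \<open>V\<close> all of them agree.\<close>

lemma diff_at_eq: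
  assumes "x \<in> \<Omega>" "u \<in> V" "(f has_derivative A) (at x within \<Omega>)"
  shows "diff_at f x u = A u"
proof -
  have "f differentiable (at x within \<Omega>)"
    using assms(3) by (rule differentiableI)
  then have "(f has_derivative diff_at f x) (at x within \<Omega>)"
    unfolding diff_at_def frechet_derivative_works .
  from cone_derivative_unique[OF assms(1,2) this assms(3)] show ?thesis .
qed

lemma has_derivative_affine_on_cone:
  assumes "linear A" "\<And>x. x \<in> \<Omega> \<Longrightarrow> f x = A x + c" "x \<in> \<Omega>"
  shows "(f has_derivative A) (at x within \<Omega>)"
proof -
  have "bounded_linear A"
    using assms(1) by (simp add: linear_conv_bounded_linear)
  then have "((\<lambda>x. A x + c) has_derivative (\<lambda>x. A x + 0)) (at x within \<Omega>)"
    by (intro has_derivative_add bounded_linear_imp_has_derivative has_derivative_const)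
  then show ?thesis
    using assms(2,3) by (auto intro: has_derivative_transform)
qed

text \<open>Affine maps rather than linear ones make the induction close: every directional
  derivative is constant, hence affine with linear part 0.\<close>

lemma Ck_on_cone_affine:
  assumes "linear A" "\<And>x. x \<in> \<Omega> \<Longrightarrow> f x = A x + c"
  shows "Ck_on_cone k f"
  using assms
proof (induction k arbitrary: f A c)
  case 0
  then have "f differentiable_on \<Omega>"
    unfolding differentiable_on_def by (blast intro: differentiableI has_derivative_affine_on_cone)
  then show ?case
    by (simp add: differentiable_imp_continuous_on)
next
  case (Suc k)
  have d: "(f has_derivative A) (at x within \<Omega>)" if "x \<in> \<Omega>" for x
    using Suc.prems that by (rule has_derivative_affine_on_cone)
  have "Ck_on_cone k (\<lambda>x. diff_at f x u)" if "u \<in> V" for u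
    by (rule Suc.IH[where A = "\<lambda>_. 0" and c = "A u"])
      (use d that in \<open>auto simp: diff_at_eq module_hom_zero intro!: linearI\<close>)
  then show ?case
    using d by (auto simp: differentiable_on_def intro: differentiableI)
qed

section \<open>Inverses, linear extensions and exponentials of automorphisms\<close>

lemma clan_automorphismD:
  assumes "clan_automorphism h"
  shows "bij_betw h V V"
    and "\<And>u. u \<in> V \<Longrightarrow> h u \<in> V"
    and "\<And>u v. u \<in> V \<Longrightarrow> v \<in> V \<Longrightarrow> h (u + v) = h u + h v"
    and "\<And>r u. u \<in> V \<Longrightarrow> h (r *\<^sub>R u) = r *\<^sub>R h u"
    and "h (mat 1) = mat 1"
    and "\<And>u v. u \<in> V \<Longrightarrow> v \<in> V \<Longrightarrow> h (u \<Delta> v) = h u \<Delta> h v"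
  using assms by (auto simp: clan_automorphism_def dest: bij_betwE)

lemma clan_automorphism_inv:
  assumes h: "clan_automorphism h"
  shows "clan_automorphism (inv_into V h)"
proof -
  note D = clan_automorphismD[OF h]
  let ?k = "inv_into V h"
  have k: "bij_betw ?k V V"
    using D(1) by (rule bij_betw_inv_into)
  have kV: "?k u \<in> V" if "u \<in> V" for u
    using k that by (rule bij_betw_apply)
  have hk: "h (?k u) = u" if "u \<in> V" for u
    using D(1) that by (rule bij_betw_inv_into_right)
  have kI: "?k v = u" if "u \<in> V" "h u = v" for u v
    using bij_betw_inv_into_left[OF D(1)] that by blast
  show ?thesis
    unfolding clan_automorphism_def
  proof (intro conjI allI ballI k)
    show "?k (u + v) = ?k u + ?k v" if "u \<in> V" "v \<in> V" for u v
      by (rule kI) (use that kV hk D subspace_V in \<open>auto intro: subspace_add\<close>)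
    show "?k (r *\<^sub>R u) = r *\<^sub>R ?k u" if "u \<in> V" for r u
      by (rule kI) (use that kV hk D subspace_V in \<open>auto intro: subspace_scale\<close>)
    show "?k (mat 1) = mat 1"
      by (rule kI) (simp_all add: D(5), simp add: mat_1_eq_vmat)
    show "?k (u \<Delta> v) = ?k u \<Delta> ?k v" if "u \<in> V" "v \<in> V" for u v
      by (rule kI) (use that kV hk D in auto)
  qed
qed

lemma clan_automorphism_linear:
  assumes h: "clan_automorphism h"
  shows "linear (h \<circ> V_proj)"
  by (intro linearI)
    (simp_all add: linear_add[OF linear_V_proj] linear_scale[OF linear_V_proj] clan_automorphismD[OF h])

lemma clan_automorphism_Exp:
  assumes h: "clan_automorphism h" and v: "v \<in> V"
  shows "h (Exp v) = Exp (h v)"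
proof -
  note D = clan_automorphismD[OF h]
  have bl: "bounded_linear (L v)" "bounded_linear V_proj" "bounded_linear (h \<circ> V_proj)"
    unfolding linear_conv_bounded_linear[symmetric]
    by (rule linear_L linear_V_proj clan_automorphism_linear[OF h])+
  have e: "mat 1 \<in> V"
    by (simp add: mat_1_eq_vmat)
  \<comment> \<open>\<open>V_proj\<close> fixes every term of the series, so the limit
    \<open>Exp v\<close> stays in \<open>V\<close>, where \<open>h\<close> is controlled.\<close>
  have "V_proj (op_exp (L v) e) = op_exp (L v) (V_proj e)"
    by (rule op_exp_intertwine[OF bl(1,2) e]) (use v in \<open>auto simp: L_def V_proj_eq\<close>)
  then have "V_proj (Exp v) = Exp v"
    using e by (simp add: Exp_def V_proj_eq)
  moreover have "(h \<circ> V_proj) (op_exp (L v) e) = op_exp (L (h v)) ((h \<circ> V_proj) e)"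
    by (rule op_exp_intertwine[OF bl(1,3) e]) (use v D in \<open>auto simp: L_def V_proj_eq\<close>)
  ultimately show ?thesis
    using e by (simp add: Exp_def V_proj_eq D(5))
qed

section \<open>Differentiability of the logarithm\<close>

text \<open>Taking \<open>exp t\<close> out of \<open>dexp s t\<close> leaves this function of
  \<open>s - t\<close>, which reduces differentiability of the divided difference to one
  variable.\<close>

definition exp_quot :: "real \<Rightarrow> real" where
  "exp_quot w = (if w = 0 then 1 else (exp w - 1) / w)"

lemma dexp_eq_exp_quot: "dexp s t = exp t * exp_quot (s - t)"
  by (simp add: dexp_def exp_quot_def right_diff_distrib flip: exp_add)

text \<open>Drop the constant term of the exponential series and divide by \<open>w\<close>. The
  resulting power series converges everywhere and so fills the removable singularity at 0.\<close>

lemma exp_quot_sums: "(\<lambda>n. (1 / fact (Suc n)) * w ^ n) sums exp_quot w"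
proof (cases "w = 0")
  case True
  then show ?thesis
    using powser_sums_zero[of "\<lambda>n. 1 / fact (Suc n) :: real"] by (simp add: exp_quot_def)
next
  case False
  have "(\<lambda>n. w ^ n /\<^sub>R fact n) sums (exp w - 1 + w ^ 0 /\<^sub>R fact 0)"
    using exp_converges[of w] by simp
  then have "(\<lambda>n. w ^ Suc n /\<^sub>R fact (Suc n)) sums (exp w - 1)"
    by (subst sums_Suc_iff)
  then have "(\<lambda>n. w ^ Suc n /\<^sub>R fact (Suc n) / w) sums ((exp w - 1) / w)"
    by (rule sums_divide)
  moreover have "w ^ Suc n /\<^sub>R fact (Suc n) / w = (1 / fact (Suc n)) * w ^ n" for n
    using False by (simp add: divide_inverse mult_ac del: fact_Suc)
  ultimately show ?thesis
    using False by (simp only: exp_quot_def if_False)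
qed

lemma exp_quot_differentiable: "exp_quot differentiable (at w)"
proof -
  have "exp_quot = (\<lambda>w. \<Sum>n. (1 / fact (Suc n)) * w ^ n)"
    using exp_quot_sums by (intro ext sums_unique)
  then show ?thesis
    using termdiffs_strong_converges_everywhere[OF sums_summable[OF exp_quot_sums]]
    unfolding real_differentiable_def by metis
qed

text \<open>\<open>Log_vmat\<close> expresses \<open>Log\<close> through matrix entries; its
  denominators stay nonzero because \<open>dexp\<close> is positive.\<close>

lemma Log_differentiable_on_cone:
  assumes x: "x \<in> \<Omega>"
  shows "Log differentiable (at x within \<Omega>)"
proof -
  let ?D = "\<lambda>x :: mat3. x$3$3 - (x$1$3)\<^sup>2 / x$1$1 - (x$2$3)\<^sup>2 / x$2$2"
  define E where "E i x = ln (x$i$i) / 2" for i and x :: mat3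
  define U where "U x = ln (?D x) / 2" for x
  define F where "F x = vmat (2 * E 1 x) (2 * E 2 x) (2 * U x)
     (x$1$3 / (exp (E 1 x) * dexp (E 1 x) (U x))) (x$2$3 / (exp (E 2 x) * dexp (E 2 x) (U x)))" for x
  have Log_eq: "Log x = F x" if "x \<in> \<Omega>" for x
    using that by (elim cone_cases) (simp add: Log_vmat F_def E_def U_def Let_def)
  have pos: "x$1$1 > 0" "x$2$2 > 0" "?D x > 0"
    using x by (auto elim: cone_cases)
  let ?F = "at x within \<Omega>"
  have entry: "(\<lambda>x :: mat3. x$i$j) differentiable ?F" for i j
    by (intro linear_imp_differentiable linearI) simp_all
  have ln: "(\<lambda>x. ln (f x)) differentiable ?F" if "f differentiable ?F" "f x > 0" for f :: "mat3 \<Rightarrow> real"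
    using that(2) by (intro differentiable_compose[OF _ that(1)])
      (auto simp: real_differentiable_def intro!: derivative_eq_intros)
  have exp: "(\<lambda>x. exp (f x)) differentiable ?F" if "f differentiable ?F" for f :: "mat3 \<Rightarrow> real"
    by (intro differentiable_compose[OF _ that])
      (auto simp: real_differentiable_def intro!: derivative_eq_intros)
  have E: "E i differentiable ?F" if "x$i$i > 0" for i
    unfolding E_def using that by (intro differentiable_divide ln entry differentiable_const) auto
  have D: "?D differentiable ?F"
    using pos unfolding power2_eq_square
    by (intro differentiable_divide differentiable_diff differentiable_mult entry) auto
  have U: "U differentiable ?F"
    unfolding U_def using pos by (intro differentiable_divide ln D differentiable_const) auto
  have dexp: "(\<lambda>x. dexp (f x) (U x)) differentiable ?F" if "f differentiable ?F" for f
    unfolding dexp_eq_exp_quot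
    by (intro differentiable_mult exp U that differentiable_compose[OF exp_quot_differentiable] differentiable_diff)
  have off: "(\<lambda>x. x$i$3 / (exp (E i x) * dexp (E i x) (U x))) differentiable ?F" if "x$i$i > 0" for i
    using dexp_pos[of "E i x" "U x"]
    by (intro differentiable_divide differentiable_mult entry exp dexp E that) auto
  have vmat: "(\<lambda>x. vmat (f1 x) (f2 x) (f3 x) (f4 x) (f5 x)) differentiable ?F"
    if "f1 differentiable ?F" "f2 differentiable ?F" "f3 differentiable ?F"
      "f4 differentiable ?F" "f5 differentiable ?F" for f1 f2 f3 f4 f5
  proof -
    have *: "vmat a b c p q = a *\<^sub>R vmat 1 0 0 0 0 + b *\<^sub>R vmat 0 1 0 0 0 + c *\<^sub>R vmat 0 0 1 0 0
        + p *\<^sub>R vmat 0 0 0 1 0 + q *\<^sub>R vmat 0 0 0 0 1" for a b c p q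
      by simp
    show ?thesis
      by (subst *) (intro differentiable_add differentiable_scaleR differentiable_const that)
  qed
  have "F differentiable ?F"
    unfolding F_def using pos
    by (intro vmat differentiable_mult differentiable_const E U off) auto
  then show ?thesis
    by (rule differentiable_transform_within[where d = 1]) (use x Log_eq in auto)
qed

section \<open>Classification of the automorphisms\<close>

lemma clan_automorphism_cases:
  assumes h: "clan_automorphism h"
  obtains (diagonal) s t where "s\<^sup>2 = 1" "t\<^sup>2 = 1"
      "\<And>a b c p q. h (vmat a b c p q) = vmat a b c (s * p) (t * q)"
  | (swap) s t where "s\<^sup>2 = 1" "t\<^sup>2 = 1"
      "\<And>a b c p q. h (vmat a b c p q) = vmat b a c (t * q) (s * p)"
proof -
  note D = clan_automorphismD[OF h]
  let ?E1 = "vmat 1 0 0 0 0" and ?E2 = "vmat 0 1 0 0 0" and ?E3 = "vmat 0 0 1 0 0"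
  let ?P1 = "vmat 0 0 0 1 0" and ?P2 = "vmat 0 0 0 0 1"
  have zero: "vmat 0 0 0 0 0 = 0"
    by (metis scale_zero_left vmat_scaleR mult_zero_left)
  have h0: "h (vmat 0 0 0 0 0) = vmat 0 0 0 0 0"
    using D(4)[of "vmat 0 0 0 0 0" 0] by (simp add: zero[symmetric])
  have inj: "h u = h v \<longleftrightarrow> u = v" if "u \<in> V" "v \<in> V" for u v
    using bij_betw_imp_inj_on[OF D(1)] that by (auto dest: inj_onD)
  have expand: "h (vmat a b c p q) = a *\<^sub>R h ?E1 + b *\<^sub>R h ?E2 + c *\<^sub>R h ?E3 + p *\<^sub>R h ?P1 + q *\<^sub>R h ?P2"
    for a b c p q
  proof -
    have "vmat a b c p q = a *\<^sub>R ?E1 + b *\<^sub>R ?E2 + c *\<^sub>R ?E3 + p *\<^sub>R ?P1 + q *\<^sub>R ?P2"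
      by simp
    then show ?thesis
      by (simp only: D(3,4) subspace_add[OF subspace_V] subspace_scale[OF subspace_V] vmat_in_V)
  qed
  have nilpotent: "\<exists>p q. h n = vmat 0 0 0 p q" if n: "n \<in> V" "n \<Delta> (n \<Delta> n) = vmat 0 0 0 0 0" for n
  proof -
    obtain a b c p q where hn: "h n = vmat a b c p q"
      using D(2)[OF n(1)] by (rule V_cases)
    have "h n \<Delta> (h n \<Delta> h n) = vmat 0 0 0 0 0"
      using n h0 by (simp flip: D(6))
    then have ab: "a = 0" "b = 0"
      and c: "c * (c * c + 2 * (p * p + q * q)) + 2 * (p * (c / 2 * p) + q * (c / 2 * q)) = 0"
      unfolding hn clan_prod_vmat by auto
    \<comment> \<open>Positivity of sums of real squares forces the third diagonal coordinate to
      vanish.\<close>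
    have "c * (c\<^sup>2 + 3 * p\<^sup>2 + 3 * q\<^sup>2) = 0"
      using c by (simp add: algebra_simps power2_eq_square)
    moreover have "c\<^sup>2 + 3 * p\<^sup>2 + 3 * q\<^sup>2 > 0" if "c \<noteq> 0"
      using that by (simp add: add_pos_nonneg)
    ultimately have "c = 0" by fastforce
    then show ?thesis
      using ab hn by blast
  qed
  obtain p1 q1 where P1: "h ?P1 = vmat 0 0 0 p1 q1"
    using nilpotent[of ?P1] by (auto simp: clan_prod_vmat)
  obtain p2 q2 where P2: "h ?P2 = vmat 0 0 0 p2 q2"
    using nilpotent[of ?P2] by (auto simp: clan_prod_vmat)
  \<comment> \<open>Both off-diagonal basis elements square to twice \<open>?E3\<close>, so their
    images have the same squared length \<open>r\<close>, and \<open>?E3\<close> is mapped to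
    \<open>r\<close> times itself.\<close>
  have E3_P: "2 *\<^sub>R h ?E3 = h ?P1 \<Delta> h ?P1" "2 *\<^sub>R h ?E3 = h ?P2 \<Delta> h ?P2"
    by (simp_all add: clan_prod_vmat flip: D(4) D(6))
  obtain a' b' r x' y' where E3': "h ?E3 = vmat a' b' r x' y'"
    using D(2)[OF vmat_in_V] by (rule V_cases)
  have E3: "h ?E3 = vmat 0 0 r 0 0" and r: "r = p1\<^sup>2 + q1\<^sup>2" "r = p2\<^sup>2 + q2\<^sup>2"
    using E3_P by (simp_all add: E3' P1 P2 clan_prod_vmat power2_eq_square)
  have "h ?E3 \<Delta> h ?E3 = h ?E3"
    by (simp add: clan_prod_vmat flip: D(6))
  then have "r = 0 \<or> r = 1"
    by (auto simp: E3 clan_prod_vmat)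
  moreover have "r \<noteq> 0"
    using inj[of ?E3 "vmat 0 0 0 0 0"] h0 E3 by auto
  ultimately have r1: "r = 1" by blast
  obtain a b c x y where E1: "h ?E1 = vmat a b c x y"
    using D(2)[OF vmat_in_V] by (rule V_cases)
  \<comment> \<open>Multiplication by \<open>?E3\<close> acts on the coordinates with factors 0, 0,
    1, 1/2, 1/2, so only the first two coordinates survive in its kernel.\<close>
  have "h ?E3 \<Delta> h ?E1 = vmat 0 0 0 0 0"
    using h0 by (simp add: clan_prod_vmat flip: D(6))
  then have cxy: "c = 0" "x = 0" "y = 0"
    by (simp_all add: E1 E3 r1 clan_prod_vmat)
  have "h ?E1 \<Delta> h ?E1 = h ?E1"
    by (simp add: clan_prod_vmat flip: D(6))
  then have ab: "a = 0 \<or> a = 1" "b = 0 \<or> b = 1"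
    by (auto simp: E1 clan_prod_vmat)
  have "h (vmat 1 1 1 0 0) = vmat 1 1 1 0 0"
    using D(5) by (simp add: mat_1_eq_vmat)
  then have "h ?E1 + h ?E2 + h ?E3 = vmat 1 1 1 0 0"
    by (simp flip: D(3))
  moreover obtain a2 b2 c2 x2 y2 where "h ?E2 = vmat a2 b2 c2 x2 y2"
    using D(2)[OF vmat_in_V] by (rule V_cases)
  ultimately have E2: "h ?E2 = vmat (1 - a) (1 - b) 0 0 0"
    by (simp add: E1 E3 r1 cxy)
  \<comment> \<open>If both were 0, \<open>h\<close> would kill \<open>?E1\<close>; if both were 1,
    it would kill \<open>?E2\<close>.\<close>
  have "a \<noteq> b"
    using inj[of ?E1 "vmat 0 0 0 0 0"] inj[of ?E2 "vmat 0 0 0 0 0"] h0 ab by (auto simp: E1 E2 cxy)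
  \<comment> \<open>\<open>?E2\<close> annihilates \<open>?P1\<close> but not \<open>?P2\<close>,
    and \<open>?E1\<close> the reverse, so the images of the idempotents decide which off-diagonal
    coordinate each image occupies.\<close>
  have off: "h ?E2 \<Delta> h ?P1 = vmat 0 0 0 0 0" "h ?E1 \<Delta> h ?P2 = vmat 0 0 0 0 0"
    using h0 by (simp_all add: clan_prod_vmat flip: D(6))
  show thesis
  proof (cases "a = 1")
    case True
    then have "b = 0" "q1 = 0" "p2 = 0"
      using \<open>a \<noteq> b\<close> ab off by (auto simp: E1 E2 P1 P2 cxy clan_prod_vmat)
    then show thesis
      using r r1 True
      by (intro diagonal[of p1 q2]; (subst expand)?) (simp_all add: E1 E2 E3 P1 P2 cxy mult.commute)
  next
    case False
    then have "a = 0" "b = 1" "p1 = 0" "q2 = 0"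
      using \<open>a \<noteq> b\<close> ab off by (auto simp: E1 E2 P1 P2 cxy clan_prod_vmat)
    then show thesis
      using r r1
      by (intro swap[of q1 p2]; (subst expand)?) (simp_all add: E1 E2 E3 P1 P2 cxy mult.commute)
  qed
qed

section \<open>Equivariance and isometry\<close>

lemma Log_in_V: "x \<in> \<Omega> \<Longrightarrow> Log x \<in> V"
  by (elim cone_cases) (simp add: Log_vmat Let_def)

lemma clan_automorphism_cone:
  assumes h: "clan_automorphism h" and x: "x \<in> \<Omega>"
  shows "h x \<in> \<Omega>"
proof -
  from x obtain a b c p q where x_eq: "x = vmat a b c p q"
    and pos: "0 < a" "0 < b" "0 < c - p\<^sup>2 / a - q\<^sup>2 / b"
    by (rule cone_cases)
  from h show ?thesis
  proof (cases rule: clan_automorphism_cases)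
    case (diagonal s t)
    then show ?thesis
      using pos by (simp add: x_eq vmat_in_cone_iff power_mult_distrib)
  next
    case (swap s t)
    then show ?thesis
      using pos by (simp add: x_eq vmat_in_cone_iff power_mult_distrib algebra_simps)
  qed
qed

lemma clan_automorphism_cone_image:
  assumes h: "clan_automorphism h"
  shows "h ` \<Omega> = \<Omega>"
proof
  show "h ` \<Omega> \<subseteq> \<Omega>"
    using clan_automorphism_cone[OF h] by blast
  show "\<Omega> \<subseteq> h ` \<Omega>"
  proof
    fix y assume y: "y \<in> \<Omega>"
    then have "h (inv_into V h y) = y"
      using cone_subset_V by (intro bij_betw_inv_into_right[OF clan_automorphismD(1)[OF h]]) blast
    then show "y \<in> h ` \<Omega>"
      using clan_automorphism_cone[OF clan_automorphism_inv[OF h] y] by (metis imageI)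
  qed
qed

text \<open>Signs square to 1, so the Schur complement is unchanged and the denominators in
  \<open>Log_vmat\<close> are at most exchanged; the numerators \<open>p\<close> and
  \<open>q\<close> transform as under \<open>h\<close>.\<close>

lemma clan_automorphism_Log:
  assumes h: "clan_automorphism h" and x: "x \<in> \<Omega>"
  shows "Log (h x) = h (Log x)"
proof -
  from x obtain a b c p q where x_eq: "x = vmat a b c p q"
    and pos: "0 < a" "0 < b" "0 < c - p\<^sup>2 / a - q\<^sup>2 / b"
    by (rule cone_cases)
  from h show ?thesis
  proof (cases rule: clan_automorphism_cases)
    case (diagonal s t)
    have "Log (vmat a b c (s * p) (t * q)) = h (Log x)"
      using pos diagonal(1,2) by (subst Log_vmat)
        (simp_all add: x_eq Log_vmat Let_def power_mult_distrib diagonal(3))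
    then show ?thesis
      by (simp add: x_eq diagonal(3))
  next
    case (swap s t)
    \<comment> \<open>The exchange of indices permutes the two subtracted terms of the Schur
      complement.\<close>
    have *: "c - q\<^sup>2 / b - p\<^sup>2 / a = c - p\<^sup>2 / a - q\<^sup>2 / b" by simp
    have "Log (vmat b a c (t * q) (s * p)) = h (Log x)"
      using pos swap(1,2) by (subst Log_vmat)
        (simp_all only: x_eq Log_vmat Let_def power_mult_distrib swap(3) * mult_1 times_divide_eq_right)
    then show ?thesis
      by (simp add: x_eq swap(3))
  qed
qed

text \<open>The trace formula involves the diagonal alone and weights \<open>a\<close> and
  \<open>b\<close> equally, so it is blind to signs and to the exchange.\<close>

lemma clan_automorphism_Q:
  assumes h: "clan_automorphism h" and "u \<in> V" "v \<in> V"
  shows "Q (h u) (h v) = Q u v"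
proof -
  obtain a b c p q where uv: "u \<Delta> v = vmat a b c p q"
    using clan_prod_in_V[OF assms(2,3)] by (rule V_cases)
  have "Q (h u) (h v) = trace_on V (L (h (u \<Delta> v)))"
    using assms by (simp add: Q_def clan_automorphismD(6)[OF h])
  also have "\<dots> = trace_on V (L (u \<Delta> v))"
    unfolding uv using h by (cases rule: clan_automorphism_cases) (simp_all add: trace_on_V_L)
  finally show ?thesis
    by (simp add: Q_def)
qed

text \<open>On the cone the inverse of the restriction agrees with the inverse automorphism of
  \<open>V\<close>, so both directions are restrictions of linear maps.\<close>

lemma clan_automorphism_diffeomorphism:
  assumes h: "clan_automorphism h"
  shows "cone_diffeomorphism h"
proof -
  let ?k = "inv_into V h"
  have k: "clan_automorphism ?k"
    using h by (rule clan_automorphism_inv)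
  have Ck: "Ck_on_cone n f" if "clan_automorphism g" "\<And>x. x \<in> \<Omega> \<Longrightarrow> f x = g x" for n f g
    by (rule Ck_on_cone_affine[OF clan_automorphism_linear[OF that(1)], where c = 0])
      (use cone_subset_V that(2) in \<open>auto simp: V_proj_eq\<close>)
  have inj: "inj_on h \<Omega>"
    using bij_betw_imp_inj_on[OF clan_automorphismD(1)[OF h]] cone_subset_V by (rule inj_on_subset)
  have "inv_into \<Omega> h y = ?k y" if y: "y \<in> \<Omega>" for y
  proof (rule inv_into_f_eq[OF inj])
    show "?k y \<in> \<Omega>"
      using k y by (rule clan_automorphism_cone)
    show "h (?k y) = y"
      using y cone_subset_V by (intro bij_betw_inv_into_right[OF clan_automorphismD(1)[OF h]]) blast
  qed
  then show ?thesis
    using inj clan_automorphism_cone_image[OF h] Ck[OF h refl] Ck[OF k]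
    by (auto simp: cone_diffeomorphism_def bij_betw_def)
qed

lemma clan_automorphism_has_derivative:
  assumes h: "clan_automorphism h" and x: "x \<in> \<Omega>"
  shows "(h has_derivative h \<circ> V_proj) (at x within \<Omega>)"
  by (rule has_derivative_affine_on_cone[OF clan_automorphism_linear[OF h] _ x, where c = 0])
    (use cone_subset_V in \<open>auto simp: V_proj_eq\<close>)

lemma has_derivative_linear_comp:
  fixes g :: "'a::euclidean_space \<Rightarrow> 'b::real_normed_vector"
  assumes "linear g" "(f has_derivative A) (at x within S)"
  shows "(g \<circ> f has_derivative g \<circ> A) (at x within S)"
  using diff_chain_within[OF assms(2) bounded_linear_imp_has_derivative[of g]] assms(1)
  by (simp add: linear_conv_bounded_linear)

lemma Log_has_derivative:
  assumes "x \<in> \<Omega>"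
  shows "(Log has_derivative diff_at Log x) (at x within \<Omega>)"
  using Log_differentiable_on_cone[OF assms] unfolding diff_at_def frechet_derivative_works .

text \<open>Differentiate \<open>V_proj \<circ> Log\<close>, which equals \<open>Log\<close> on the
  cone.\<close>

lemma diff_at_Log_in_V:
  assumes x: "x \<in> \<Omega>" and u: "u \<in> V"
  shows "diff_at Log x u \<in> V"
proof -
  have "(V_proj \<circ> Log has_derivative V_proj \<circ> diff_at Log x) (at x within \<Omega>)"
    by (intro has_derivative_linear_comp linear_V_proj Log_has_derivative x)
  then have "(Log has_derivative V_proj \<circ> diff_at Log x) (at x within \<Omega>)"
    using x by (rule has_derivative_transform[rotated 2]) (simp add: V_proj_eq Log_in_V)
  from diff_at_eq[OF x u this] have eq: "diff_at Log x u = V_proj (diff_at Log x u)"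
    by simp
  show ?thesis
    by (subst eq) simp
qed

lemma clan_automorphism_diff_Log:
  assumes h: "clan_automorphism h" and x: "x \<in> \<Omega>" and u: "u \<in> V"
  shows "diff_at Log (h x) (h u) = h (diff_at Log x u)"
proof -
  have hx: "h x \<in> \<Omega>"
    using h x by (rule clan_automorphism_cone)
  \<comment> \<open>The chain rule wants the outer derivative within the image of the cone, which is
    the cone itself.\<close>
  have "(Log has_derivative diff_at Log (h x)) (at (h x) within h ` \<Omega>)"
    using Log_has_derivative[OF hx] by (simp only: clan_automorphism_cone_image[OF h])
  with clan_automorphism_has_derivative[OF h x]
  have 1: "(Log \<circ> h has_derivative diff_at Log (h x) \<circ> (h \<circ> V_proj)) (at x within \<Omega>)"
    by (rule diff_chain_within)
  have "((h \<circ> V_proj) \<circ> Log has_derivative (h \<circ> V_proj) \<circ> diff_at Log x) (at x within \<Omega>)"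
    by (intro has_derivative_linear_comp clan_automorphism_linear Log_has_derivative h x)
  then have 2: "(Log \<circ> h has_derivative (h \<circ> V_proj) \<circ> diff_at Log x) (at x within \<Omega>)"
    using x by (rule has_derivative_transform[rotated 2])
      (simp add: V_proj_eq Log_in_V clan_automorphism_Log[OF h])
  show ?thesis
    using cone_derivative_unique[OF x u 1 2] u diff_at_Log_in_V[OF x u] by (simp add: V_proj_eq)
qed

theorem proposition7p8:
  fixes h :: "mat3 \<Rightarrow> mat3"
  assumes "clan_automorphism h"
  shows "h ` \<Omega> = \<Omega> \<and>
         (\<forall>x\<in>\<Omega>. Log (h x) = h (Log x)) \<and>
         (\<forall>x\<in>\<Omega>. \<forall>y\<in>\<Omega>. \<forall>t\<in>{0..1}.
            h (log_vinberg_path x y t) = log_vinberg_path (h x) (h y) t) \<and>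
         cone_isometry log_metric h"
proof (intro conjI ballI)
  note D = clan_automorphismD[OF assms]
  show "h ` \<Omega> = \<Omega>"
    using assms by (rule clan_automorphism_cone_image)
  show "Log (h x) = h (Log x)" if "x \<in> \<Omega>" for x
    using assms that by (rule clan_automorphism_Log)
  show "h (log_vinberg_path x y t) = log_vinberg_path (h x) (h y) t"
    if "x \<in> \<Omega>" "y \<in> \<Omega>" for x y t
    using that unfolding log_vinberg_path_def
    by (simp add: clan_automorphism_Exp[OF assms] clan_automorphism_Log[OF assms] D(3,4) Log_in_V
        subspace_add[OF subspace_V] subspace_scale[OF subspace_V])
  have "log_metric (h x) (diff_at h x u) (diff_at h x v) = log_metric x u v"
    if x: "x \<in> \<Omega>" and u: "u \<in> V" and v: "v \<in> V" for x u v
  proof -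
    have "diff_at h x w = h w" if "w \<in> V" for w
      using diff_at_eq[OF x that clan_automorphism_has_derivative[OF assms x]] that
      by (simp add: V_proj_eq)
    then show ?thesis
      using u v by (simp add: log_metric_def clan_automorphism_diff_Log[OF assms x]
          clan_automorphism_Q[OF assms] diff_at_Log_in_V[OF x])
  qed
  then show "cone_isometry log_metric h"
    using clan_automorphism_diffeomorphism[OF assms] by (simp add: cone_isometry_def)
qed

end
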